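(* Let $\lambda\in\mathbb{F}_{q^n}\setminus\mathbb{F}_q$ with $\mathbb{F}_q(\lambda)=\mathbb{F}_{q^n}$, let $f(x)=a_0+a_1x+\dots+a_{n-1}x^{n-1}+x^n\in\mathbb{F}_q[x]$ be the minimal polynomial of $\lambda$ over $\mathbb{F}_q$ (set $a_n=1$), let $\delta=f'(\lambda)$, and let $1\le t\le n-1$. Let \[L=\{\langle(\alpha_0+\alpha_1\lambda+\dots+\alpha_{t-1}\lambda^{t-1},\ \beta_0+\beta_1\lambda+\dots+\beta_{n-t-1}\lambda^{n-t-1})\rangle_{\mathbb{F}_{q^n}}\colon \alpha_i,\beta_i\in\mathbb{F}_q \text{ not all zero}\}.\] Then $L$ is $\mathrm{PGL}(2,q^n)$-equivalent to $L_p=\{\langle(x,p(x))\rangle_{\mathbb{F}_{q^n}}\colon x\in\mathbb{F}_{q^n}^*\}$, where \[p(x)=\sum_{i=t}^{n-1}\lambda^i\,\mathrm{Tr}_{q^n/q}((\lambda^i)^*x)=\sum_{j=0}^{n-1}A_jx^{q^j},\qquad A_j=\frac{1}{\delta^{q^j}}\sum_{i=t}^{n-1}\sum_{h=1}^{n-i}\lambda^{i+(h-1)q^j}a_{i+h}^{q^j},\] and $((\lambda^0)^*,\dots,(\lambda^{n-1})^* )$ denotes the dual basis of $(1,\lambda,\dots,\lambda^{n-1})$.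
   Context: $\mathrm{Tr}_{q^n/q}(a)=\sum_{i=0}^{n-1}a^{q^i}$. Two ordered $\mathbb{F}_q$-bases $(\xi_i)$, $(\xi_i^* )$ of $\mathbb{F}_{q^n}$ are dual if $\mathrm{Tr}_{q^n/q}(\xi_i\xi_j^* )=\delta_{ij}$. Points of $\mathrm{PG}(1,q^n)$ are $\langle \mathbf v\rangle_{\mathbb{F}_{q^n}}$, $\mathbf v\in\mathbb{F}_{q^n}^2\setminus\{\mathbf 0\}$. *)

theory Defs
  imports
    "HOL-Analysis.Cartesian_Space"
    "HOL-Computational_Algebra.Polynomial"
begin

text \<open>
  The field \<open>F_{q^n}\<close> is a finite field type \<open>'a\<close>, and \<open>F_q\<close> is a subfield given by its carrier
  set \<open>K\<close>.
\<close>

definition is_subfield :: "'a::field set \<Rightarrow> bool" where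
  "is_subfield F \<longleftrightarrow>
     0 \<in> F \<and> 1 \<in> F \<and>
     (\<forall>x\<in>F. \<forall>y\<in>F. x + y \<in> F \<and> x * y \<in> F) \<and>
     (\<forall>x\<in>F. - x \<in> F \<and> inverse x \<in> F)"

definition adjoin :: "'a::field set \<Rightarrow> 'a \<Rightarrow> 'a set" where
  "adjoin K a = \<Inter> {F. is_subfield F \<and> K \<subseteq> F \<and> a \<in> F}"

definition minimal_polynomial :: "'a::field set \<Rightarrow> 'a \<Rightarrow> 'a poly \<Rightarrow> bool" where
  "minimal_polynomial K a f \<longleftrightarrow>
     set (coeffs f) \<subseteq> K \<and> lead_coeff f = 1 \<and> poly f a = 0 \<and>
     (\<forall>g. g \<noteq> 0 \<longrightarrow> set (coeffs g) \<subseteq> K \<longrightarrow> poly g a = 0 \<longrightarrow> degree f \<le> degree g)"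

text \<open>The trace map from \<open>F_{q^n}\<close> to \<open>F_q\<close>.\<close>

definition trace :: "nat \<Rightarrow> nat \<Rightarrow> 'a::field \<Rightarrow> 'a" where
  "trace q n a = (\<Sum>i<n. a ^ (q ^ i))"

text \<open>Ordered families are lists; all scalars are taken from \<open>K\<close>.\<close>

definition lin_independent_over :: "'a::field set \<Rightarrow> 'a list \<Rightarrow> bool" where
  "lin_independent_over K bs \<longleftrightarrow>
     (\<forall>c. (\<forall>i<length bs. c i \<in> K) \<and> (\<Sum>i<length bs. c i * bs ! i) = 0
          \<longrightarrow> (\<forall>i<length bs. c i = 0))"

definition spanning_over :: "'a::field set \<Rightarrow> 'a list \<Rightarrow> bool" where
  "spanning_over K bs \<longleftrightarrow>
     (\<forall>x. \<exists>c. (\<forall>i<length bs. c i \<in> K) \<and> x = (\<Sum>i<length bs. c i * bs ! i))"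

definition ordered_basis :: "'a::field set \<Rightarrow> 'a list \<Rightarrow> bool" where
  "ordered_basis K bs \<longleftrightarrow> lin_independent_over K bs \<and> spanning_over K bs"

definition dual_bases :: "'a::field set \<Rightarrow> nat \<Rightarrow> nat \<Rightarrow> 'a list \<Rightarrow> 'a list \<Rightarrow> bool" where
  "dual_bases K q n bs cs \<longleftrightarrow>
     ordered_basis K bs \<and> ordered_basis K cs \<and>
     (\<forall>i<length bs. \<forall>j<length cs. trace q n (bs ! i * cs ! j) = (if i = j then 1 else 0))"

text \<open>
  Every ordered basis of \<open>F_{q^n}\<close> over \<open>F_q\<close> has exactly one dual basis, so the description
  is proper for those.
\<close>

definition dual_basis :: "'a::field set \<Rightarrow> nat \<Rightarrow> nat \<Rightarrow> 'a list \<Rightarrow> 'a list" where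
  "dual_basis K q n bs = (THE cs. dual_bases K q n bs cs)"

text \<open>
  The point of \<open>PG(1, F)\<close> with homogeneous coordinates \<open>(x, y)\<close>, as a one-dimensional
  subspace of \<open>F^2\<close>. It is a genuine point only for \<open>(x, y) \<noteq> (0, 0)\<close>.
\<close>

definition pt :: "'a::field \<Rightarrow> 'a \<Rightarrow> ('a ^ 2) set" where
  "pt x y = vec.span {vector [x, y]}"

text \<open>
  \<open>PGL(2, F)\<close> as a group of permutations of the points: matrices in \<open>GL(2, F)\<close> that differ by a
  nonzero scalar induce the same map.
\<close>

definition PGL2 :: "(('a::field ^ 2) set \<Rightarrow> ('a ^ 2) set) set" where
  "PGL2 = {(\<lambda>P. (*v) M ` P) | M :: 'a ^ 2 ^ 2. invertible M}"

definition PGL2_equivalent :: "('a::field ^ 2) set set \<Rightarrow> ('a ^ 2) set set \<Rightarrow> bool" where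
  "PGL2_equivalent L L' \<longleftrightarrow> (\<exists>\<phi>\<in>PGL2. \<phi> ` L = L')"

end

theory Submission
  imports Defs "HOL-Algebra.Sylow"
begin

text \<open>
  Every \<open>x\<close> is uniquely \<open>u + \<lambda>\<^sup>t v\<close> with \<open>u\<close> in the span of \<open>1, \<dots>, \<lambda>\<^sup>t\<^sup>-\<^sup>1\<close> and \<open>v\<close> in
  the span of \<open>1, \<dots>, \<lambda>\<^sup>n\<^sup>-\<^sup>t\<^sup>-\<^sup>1\<close>, and \<open>p\<close> is the projection \<open>x \<mapsto> \<lambda>\<^sup>t v\<close>. Hence the matrix with
  rows \<open>(1, \<lambda>\<^sup>t)\<close> and \<open>(0, \<lambda>\<^sup>t)\<close> sends \<open>(u, v)\<close> to \<open>(x, p x)\<close>. The coefficients \<open>A\<^sub>j\<close> come from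
  Euler's description of the dual basis: \<open>(\<lambda>\<^sup>i)\<^sup>* = \<gamma>\<^sub>i / f'(\<lambda>)\<close>, where \<open>f(X) / (X - \<lambda>) = \<Sum> \<gamma>\<^sub>i X\<^sup>i\<close>.
\<close>

section \<open>The order of a finite field is a power of its characteristic\<close>

lemma group_of_addition:
  "group \<lparr>carrier = (UNIV :: 'a::ab_group_add set), monoid.mult = (+), one = (0::'a)\<rparr>"
  by (rule groupI) (auto simp: add.assoc intro: exI[of _ "- x" for x])

lemma prime_CHAR_finite_field: "prime CHAR('a::{field,finite})"
  by (intro prime_CHAR_semidom finite_imp_CHAR_pos) simp

lemma prime_dvd_card_finite_field:
  assumes "prime r" "r dvd CARD('a::{field,finite})"
  shows "r = CHAR('a)"
proof -
  define G where "G = \<lparr>carrier = (UNIV :: 'a set), monoid.mult = (+), one = (0::'a)\<rparr>"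
  interpret group G
    unfolding G_def by (rule group_of_addition)
  \<comment> \<open>Exponent \<open>1\<close> makes this Cauchy's theorem: a subgroup \<open>H\<close> of order \<open>r\<close>;
    translating its elements by \<open>x\<close> gives \<open>r x = 0\<close>.\<close>
  obtain m where "CARD('a) = r ^ 1 * m"
    using assms(2) by (auto elim: dvdE)
  then have "\<exists>H. subgroup H G \<and> card H = r ^ 1"
    by (intro sylow_thm[of r G 1 m] assms(1) is_group) (simp_all add: order_def G_def)
  then obtain H where H: "subgroup H G" "card H = r"
    by auto
  have "\<not> H \<subseteq> {0}"
    using H(2) prime_gt_1_nat[OF assms(1)] card_mono[of "{0::'a}" H] by auto
  then obtain x where x: "x \<in> H" "x \<noteq> 0"
    by auto
  have "h + x \<in> H" "h - x \<in> H" if "h \<in> H" for h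
  proof -
    have "inv\<^bsub>G\<^esub> x = - x"
      by (rule inv_equality) (simp_all add: G_def)
    then show "h + x \<in> H" "h - x \<in> H"
      using subgroup.m_closed[OF H(1) that, of x] subgroup.m_closed[OF H(1) that, of "- x"]
        subgroup.m_inv_closed[OF H(1) x(1)] x(1) by (simp_all add: G_def)
  qed
  then have "(\<Sum>h\<in>H. h + x) = \<Sum>H"
    by (intro sum.reindex_bij_witness[of _ "\<lambda>h. h - x" "\<lambda>h. h + x"]) auto
  then have "of_nat r * x = 0"
    using H(2) by (simp add: sum.distrib)
  then have "CHAR('a) dvd r"
    using x(2) by (simp add: of_nat_eq_0_iff_char_dvd)
  then show ?thesis
    using assms(1) prime_CHAR_finite_field[where 'a='a] primes_dvd_imp_eq by metis
qed

text \<open>At most one prime divides the order, by the preceding lemma. Additivity of the map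
  \<open>x ^ q\<close> will rest on this.\<close>

lemma card_finite_field_power_CHAR:
  "\<exists>k. CARD('a::{field,finite}) = CHAR('a) ^ k"
proof -
  have "prime_factors (CARD('a)) \<subseteq> {CHAR('a)}"
    using prime_dvd_card_finite_field[where 'a='a] by (auto simp: prime_factors_dvd)
  then consider "prime_factors (CARD('a)) = {}" | "prime_factors (CARD('a)) = {CHAR('a)}"
    by blast
  then show ?thesis
  proof cases
    case 1
    then show ?thesis
      using prod_prime_factors[of "CARD('a)"] by (intro exI[of _ 0]) simp
  next
    case 2
    then show ?thesis
      using prod_prime_factors[of "CARD('a)"]
      by (intro exI[of _ "multiplicity CHAR('a) (CARD('a))"]) simp
  qed
qed

section \<open>Division of a polynomial by a linear factor, and Euler's formula\<close>

lemma coeff_synthetic_div: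
  fixes f :: "'a::comm_semiring_1 poly"
  shows "coeff (synthetic_div f a) i = (\<Sum>h=1..degree f - i. a ^ (h - 1) * coeff f (i + h))"
proof (induction f arbitrary: i)
  case (pCons c f)
  show ?case
  proof (cases "f = 0")
    case False
    show ?thesis
    proof (cases i)
      \<comment> \<open>Horner's scheme: the constant term of the quotient of
        \<open>pCons c f\<close> is the value \<open>poly f a\<close>; the higher coefficients are
        those of the quotient of \<open>f\<close>.\<close>
      case 0
      have "(\<Sum>h=1..Suc (degree f). a ^ (h - 1) * coeff (pCons c f) h)
          = (\<Sum>h=0..degree f. a ^ h * coeff f h)"
        by (simp only: One_nat_def sum.shift_bounds_cl_Suc_ivl diff_Suc_Suc coeff_pCons_Suc diff_zero)
      then show ?thesis
        using 0 False by (simp add: poly_altdef atMost_atLeast0 mult.commute del: sum.cl_ivl_Suc)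
    next
      case (Suc i')
      then show ?thesis
        using pCons.IH[of i'] False by simp
    qed
  qed (simp add: pCons)
qed simp

text \<open>Differentiate \<open>f = (X - a) * g\<close>, with \<open>g\<close> the quotient, and
  evaluate at \<open>a\<close>.\<close>

lemma poly_pderiv_root:
  fixes f :: "'a::field poly"
  assumes "poly f a = 0"
  shows "poly (pderiv f) a = poly (synthetic_div f a) a"
proof -
  have "f = [:-a, 1:] * synthetic_div f a"
    using synthetic_div_correct'[of a f] assms by simp
  then have "pderiv f = pderiv ([:-a, 1:] * synthetic_div f a)"
    by simp
  also have "\<dots> = [:-a, 1:] * pderiv (synthetic_div f a) + synthetic_div f a"
    by (simp only: pderiv_mult) (simp add: pderiv_pCons)
  finally show ?thesis
    by simp
qed

lemma poly_synthetic_div_other_root: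
  fixes f :: "'a::field poly"
  assumes "poly f a = 0" "poly f b = 0" "a \<noteq> b"
  shows "poly (synthetic_div f a) b = 0"
proof -
  have "f = [:-a, 1:] * synthetic_div f a"
    using synthetic_div_correct'[of a f] assms by simp
  then have "poly f b = poly ([:-a, 1:] * synthetic_div f a) b"
    by simp
  then have "poly f b = (b - a) * poly (synthetic_div f a) b"
    by (simp only: poly_mult) simp
  then show ?thesis
    using assms by simp
qed

text \<open>If the derivative vanished at \<open>a j\<close>, the quotient by \<open>X - a j\<close>
  would vanish at all \<open>n\<close> roots while having degree \<open>n - 1\<close>, hence be
  zero.\<close>

lemma simple_roots_pderiv_nonzero:
  fixes f :: "'a::field poly"
  assumes "degree f = n" "f \<noteq> 0" "inj_on a {..<n}" "\<And>j. j < n \<Longrightarrow> poly f (a j) = 0" "j < n"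
  shows "poly (pderiv f) (a j) \<noteq> 0"
proof
  assume "poly (pderiv f) (a j) = 0"
  then have "poly (synthetic_div f (a j)) (a j) = 0"
    using poly_pderiv_root assms(4,5) by metis
  then have "poly (synthetic_div f (a j)) x = poly 0 x" if "x \<in> a ` {..<n}" for x
    using that poly_synthetic_div_other_root[of f "a j" x] assms(4,5) by (cases "x = a j") auto
  then have "synthetic_div f (a j) = 0"
    by (rule poly_eqI_degree) (use assms in \<open>auto simp: card_image degree_synthetic_div\<close>)
  \<comment> \<open>A zero quotient makes \<open>f\<close> constant, against
    \<open>j < n = degree f\<close>.\<close>
  then show False
    using assms by (simp add: synthetic_div_eq_0_iff)
qed

text \<open>
  Euler's formula: compare coefficients in the Lagrange interpolation of \<open>X ^ k\<close> at the roots of \<open>f\<close>.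
\<close>

lemma sum_root_powers_synthetic_div:
  fixes f :: "'a::field poly"
  assumes "degree f = n" "f \<noteq> 0" "inj_on a {..<n}" "\<And>j. j < n \<Longrightarrow> poly f (a j) = 0" "k < n"
  shows "(\<Sum>j<n. a j ^ k * (coeff (synthetic_div f (a j)) i / poly (pderiv f) (a j)))
           = (if i = k then 1 else 0)"
proof -
  define P where "P = (\<Sum>j<n. smult (a j ^ k / poly (pderiv f) (a j)) (synthetic_div f (a j)))"
  have "poly P (a m) = a m ^ k" if "m < n" for m
  proof -
    have "poly P (a m) = (\<Sum>j<n. a j ^ k / poly (pderiv f) (a j) * poly (synthetic_div f (a j)) (a m))"
      by (simp add: P_def poly_sum)
    also have "\<dots> = (\<Sum>j<n. if j = m then a m ^ k else 0)"
    proof (rule sum.cong)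
      fix j assume j: "j \<in> {..<n}"
      show "a j ^ k / poly (pderiv f) (a j) * poly (synthetic_div f (a j)) (a m)
          = (if j = m then a m ^ k else 0)"
      \<comment> \<open>At \<open>a j\<close> the quotient by \<open>X - a j\<close> takes the value
        of the derivative, which cancels the denominator; at every other root it vanishes.\<close>
      proof (cases "j = m")
        case True
        then show ?thesis
          using simple_roots_pderiv_nonzero[OF assms(1-4) that] poly_pderiv_root[OF assms(4)[OF that]]
          by simp
      next
        case False
        then have "a j \<noteq> a m"
          using inj_onD[OF assms(3)] j that by blast
        then show ?thesis
          using poly_synthetic_div_other_root[of f "a j" "a m"] assms(4) j that False by simp
      qed
    qed simp
    finally show ?thesis
      using that by simp
  qed
  moreover have "degree P < n"
    unfolding P_def using assms(5)
    by (intro degree_sum_less) (simp_all add: degree_synthetic_div assms(1))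
  \<comment> \<open>Both polynomials have degree below \<open>n\<close> and agree at the
    \<open>n\<close> distinct points \<open>a j\<close>.\<close>
  ultimately have "P = monom 1 k"
    using assms(5) card_image[OF assms(3)]
    by (intro poly_eqI_degree[of "a ` {..<n}"]) (auto simp: poly_monom degree_monom_eq)
  then have "coeff P i = (if k = i then 1 else 0)"
    by simp
  moreover have "coeff P i = (\<Sum>j<n. a j ^ k * (coeff (synthetic_div f (a j)) i / poly (pderiv f) (a j)))"
    by (simp add: P_def coeff_sum)
  ultimately show ?thesis
    by (simp add: eq_commute[of i k])
qed

section \<open>Frobenius powers and the trace of the extension\<close>

locale finite_field_extension =
  fixes K :: "'a::{field,finite} set" and q n :: nat
  assumes subfield: "is_subfield K" and card_K: "card K = q" and card_UNIV: "CARD('a) = q ^ n"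
begin

lemma zero_K: "0 \<in> K" and one_K: "1 \<in> K"
  and add_K: "x \<in> K \<Longrightarrow> y \<in> K \<Longrightarrow> x + y \<in> K"
  and mult_K: "x \<in> K \<Longrightarrow> y \<in> K \<Longrightarrow> x * y \<in> K"
  and uminus_K: "x \<in> K \<Longrightarrow> - x \<in> K"
  and inverse_K: "x \<in> K \<Longrightarrow> inverse x \<in> K"
  using subfield by (auto simp: is_subfield_def)

lemma diff_K: "x \<in> K \<Longrightarrow> y \<in> K \<Longrightarrow> x - y \<in> K"
  using add_K[of x "- y"] uminus_K by simp

lemma of_nat_K: "of_nat m \<in> K"
  by (induction m) (auto intro: zero_K one_K add_K)

lemma q_gt_1: "q > 1"
proof -
  have "card {0, 1 :: 'a} \<le> card K"
    by (rule card_mono) (auto intro: zero_K one_K)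
  then show ?thesis
    using card_K by simp
qed

lemma n_pos: "n > 0"
proof (rule ccontr)
  assume "\<not> n > 0"
  then have "CARD('a) = 1"
    using card_UNIV by simp
  then show False
    using zero_neq_one[where 'a='a] by (metis card_1_singletonE UNIV_I singletonD)
qed

text \<open>Since \<open>n > 0\<close>, \<open>q\<close> divides the order \<open>q ^ n\<close>,
  which is a power of the prime characteristic.\<close>

lemma q_power_CHAR: "\<exists>k. q = CHAR('a) ^ k"
proof -
  obtain k where "CARD('a) = CHAR('a) ^ k"
    using card_finite_field_power_CHAR by blast
  then have "q dvd CHAR('a) ^ k"
    using card_UNIV n_pos by (metis dvd_power)
  then show ?thesis
    using divides_primepow_nat[OF prime_CHAR_finite_field] by blast
qed

lemma frobenius_sum: "sum g A ^ (q ^ i) = (\<Sum>x\<in>A. g x ^ (q ^ i))" for g :: "'b \<Rightarrow> 'a"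
proof -
  obtain k where "q = CHAR('a) ^ k"
    using q_power_CHAR by blast
  then show ?thesis
    by (intro freshmans_dream_sum'[of _ "k * i"] prime_CHAR_finite_field) (simp add: power_mult)
qed

lemma frobenius_add: "(x + y) ^ (q ^ i) = x ^ (q ^ i) + y ^ (q ^ i)" for x y :: 'a
proof -
  obtain k where "q = CHAR('a) ^ k"
    using q_power_CHAR by blast
  then show ?thesis
    by (intro freshmans_dream'[of _ "k * i"] prime_CHAR_finite_field) (simp add: power_mult)
qed

lemma frobenius_minus: "(- x) ^ (q ^ i) = - (x ^ (q ^ i))" for x :: 'a
  using frobenius_add[of x "- x" i] q_gt_1 by (simp add: power_0_left eq_neg_iff_add_eq_0 add.commute)

lemma frobenius_diff: "(x - y) ^ (q ^ i) = x ^ (q ^ i) - y ^ (q ^ i)" for x y :: 'a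
  using frobenius_add[of x "- y" i] by (simp only: frobenius_minus add_uminus_conv_diff)

lemma frobenius_inj: "x ^ (q ^ i) = y ^ (q ^ i) \<Longrightarrow> x = y" for x y :: 'a
  using frobenius_diff[of x y i] by simp

text \<open>Fermat's argument: multiplication by a nonzero \<open>c\<close> permutes
  \<open>K - {0}\<close>, and comparing the products gives \<open>c ^ (q - 1) = 1\<close>.\<close>

lemma frobenius_K:
  assumes "c \<in> K"
  shows "c ^ (q ^ i) = c"
proof -
  have "c ^ q = c"
  proof (cases "c = 0")
    case False
    have "(\<Prod>y\<in>K - {0}. c * y) = \<Prod>(K - {0})"
      by (rule prod.reindex_bij_witness[of _ "\<lambda>y. inverse c * y" "\<lambda>y. c * y"])
         (use False assms in \<open>auto intro: mult_K inverse_K\<close>)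
    then have "c ^ (q - 1) * \<Prod>(K - {0}) = \<Prod>(K - {0})"
      using card_K zero_K by (simp add: prod.distrib)
    then have "c ^ (q - 1) = 1"
      by simp
    then show ?thesis
      using q_gt_1 by (cases q) auto
  qed (use q_gt_1 in simp)
  then show ?thesis
    by (induction i) (simp_all add: power_mult)
qed

lemma trace_combination:
  assumes "\<And>i. i < m \<Longrightarrow> c i \<in> K"
  shows "trace q n (\<Sum>i<m. c i * g i) = (\<Sum>i<m. c i * trace q n (g i))"
proof -
  have "trace q n (\<Sum>i<m. c i * g i) = (\<Sum>j<n. \<Sum>i<m. c i * g i ^ (q ^ j))"
    unfolding trace_def using assms
    by (intro sum.cong refl) (simp add: frobenius_sum power_mult_distrib frobenius_K)
  also have "\<dots> = (\<Sum>i<m. c i * trace q n (g i))"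
    by (subst sum.swap) (simp add: trace_def sum_distrib_left)
  finally show ?thesis .
qed

lemma trace_diff: "trace q n (x - y) = trace q n x - trace q n (y::'a)"
  by (simp add: trace_def frobenius_diff sum_subtractf)

section \<open>Bases and dual bases over \<open>K\<close>, by counting\<close>

lemma inj_on_combination:
  assumes "lin_independent_over K bs"
  shows "inj_on (\<lambda>c. \<Sum>i<length bs. c i * bs ! i) (PiE {..<length bs} (\<lambda>_. K))"
proof (rule inj_onI)
  fix c d assume cd: "c \<in> PiE {..<length bs} (\<lambda>_. K)" "d \<in> PiE {..<length bs} (\<lambda>_. K)"
    and eq: "(\<Sum>i<length bs. c i * bs ! i) = (\<Sum>i<length bs. d i * bs ! i)"
  have "(\<Sum>i<length bs. (c i - d i) * bs ! i) = 0"
    unfolding left_diff_distrib sum_subtractf eq by simp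
  moreover have "c i - d i \<in> K" if "i < length bs" for i
    using cd that by (auto intro: diff_K)
  ultimately have "\<forall>i<length bs. c i - d i = 0"
    using spec[OF assms[unfolded lin_independent_over_def], of "\<lambda>i. c i - d i"] by blast
  \<comment> \<open>Members of \<open>PiE\<close> agree off the index range by convention, so
    agreement on the range is equality. This is what makes coefficient families countable.\<close>
  then show "c = d"
    by (intro PiE_ext[OF cd]) simp
qed

lemma card_combination: "card (PiE {..<m::nat} (\<lambda>_. K)) = q ^ m"
  by (simp add: card_PiE card_K)

text \<open>Counting replaces dimension theory: independence gives \<open>q ^ length bs\<close>
  distinct combinations, which exhaust a field of \<open>q ^ n\<close> elements exactly when the
  exponents agree.\<close>

lemma ordered_basis_iff:
  "ordered_basis K bs \<longleftrightarrow> lin_independent_over K bs \<and> length bs = n"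
proof -
  define h where "h = (\<lambda>c. \<Sum>i<length bs. c i * bs ! i)"
  define C where "C = PiE {..<length bs} (\<lambda>_. K)"
  have card: "card (h ` C) = q ^ length bs" if "lin_independent_over K bs"
    using inj_on_combination[OF that] card_combination[of "length bs"]
    unfolding h_def C_def by (simp add: card_image)
  have "spanning_over K bs \<longleftrightarrow> h ` C = UNIV"
  proof
    assume span: "spanning_over K bs"
    have "x \<in> h ` C" for x
    proof -
      obtain c where c: "\<forall>i<length bs. c i \<in> K" "x = h c"
        using span unfolding spanning_over_def h_def by blast
      \<comment> \<open>Spanning leaves \<open>c\<close> arbitrary off the index range; restriction
        brings it into \<open>C\<close> without changing the sum.\<close>
      then have "restrict c {..<length bs} \<in> C" "x = h (restrict c {..<length bs})"
        by (auto simp: C_def h_def)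
      then show ?thesis
        by blast
    qed
    then show "h ` C = UNIV"
      by blast
  next
    assume onto: "h ` C = UNIV"
    show "spanning_over K bs"
      unfolding spanning_over_def
    proof
      fix x
      obtain c where "c \<in> C" "x = h c"
        using onto by blast
      then show "\<exists>c. (\<forall>i<length bs. c i \<in> K) \<and> x = (\<Sum>i<length bs. c i * bs ! i)"
        by (intro exI[of _ c]) (auto simp: C_def h_def)
    qed
  qed
  moreover have "h ` C = UNIV \<longleftrightarrow> length bs = n" if "lin_independent_over K bs"
  proof -
    have "h ` C = UNIV \<longleftrightarrow> card (h ` C) = CARD('a)"
      by (metis card_subset_eq finite_class.finite_UNIV subset_UNIV)
    then show ?thesis
      using card[OF that] card_UNIV q_gt_1 by simp
  qed
  ultimately show ?thesis
    unfolding ordered_basis_def by blast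
qed

text \<open>Expand \<open>cs ! j - ds ! j\<close> in \<open>cs\<close>. The trace pairing with
  \<open>bs ! k\<close> isolates the coefficient \<open>c k\<close>, and it kills the difference
  because both lists pair with \<open>bs\<close> in the same way.\<close>

lemma dual_bases_unique:
  assumes "dual_bases K q n bs cs" "dual_bases K q n bs ds"
  shows "cs = ds"
proof (rule nth_equalityI)
  have len: "length bs = n" "length cs = n" "length ds = n"
    using assms by (auto simp: dual_bases_def ordered_basis_iff)
  then show "length cs = length ds"
    by simp
  fix j assume "j < length cs"
  then have j: "j < n"
    using len by simp
  have "spanning_over K bs" "spanning_over K cs"
    using assms by (auto simp: dual_bases_def ordered_basis_def)
  then obtain c where c: "\<forall>i<n. c i \<in> K" "cs ! j - ds ! j = (\<Sum>i<n. c i * cs ! i)"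
    unfolding spanning_over_def len by blast
  have "c k = 0" if k: "k < n" for k
  proof -
    have "c k = (\<Sum>i<n. c i * (if k = i then 1 else 0))"
      using k by (simp add: if_distrib[of "(*) _"] cong: if_cong)
    also have "\<dots> = (\<Sum>i<n. c i * trace q n (bs ! k * cs ! i))"
      using assms(1) k len by (intro sum.cong) (auto simp: dual_bases_def)
    also have "\<dots> = trace q n (bs ! k * (\<Sum>i<n. c i * cs ! i))"
      using c(1) by (subst trace_combination[symmetric]) (auto simp: sum_distrib_left mult_ac)
    also have "\<dots> = trace q n (bs ! k * cs ! j) - trace q n (bs ! k * ds ! j)"
      using c(2) by (metis right_diff_distrib trace_diff)
    also have "\<dots> = 0"
      using assms j k len by (simp add: dual_bases_def)
    finally show ?thesis .
  qed
  then show "cs ! j = ds ! j"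
    using c(2) by simp
qed

text \<open>The trace pairing of a vanishing combination with \<open>bs ! k\<close> leaves only its
  coefficient \<open>c k\<close>.\<close>

lemma lin_independent_over_of_trace:
  assumes "length bs = length cs"
    and "\<And>i j. i < length bs \<Longrightarrow> j < length cs
           \<Longrightarrow> trace q n (bs ! i * cs ! j) = (if i = j then 1 else 0)"
  shows "lin_independent_over K cs"
  unfolding lin_independent_over_def
proof (intro allI impI)
  fix c k assume c: "(\<forall>i<length cs. c i \<in> K) \<and> (\<Sum>i<length cs. c i * cs ! i) = 0"
    and k: "k < length cs"
  have "c k = (\<Sum>i<length cs. c i * (if k = i then 1 else 0))"
    using k by (simp add: if_distrib[of "(*) _"] cong: if_cong)
  also have "\<dots> = (\<Sum>i<length cs. c i * trace q n (bs ! k * cs ! i))"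
    using assms k by (intro sum.cong) auto
  also have "\<dots> = trace q n (\<Sum>i<length cs. c i * (bs ! k * cs ! i))"
    using c by (intro trace_combination[symmetric]) auto
  also have "(\<Sum>i<length cs. c i * (bs ! k * cs ! i)) = bs ! k * (\<Sum>i<length cs. c i * cs ! i)"
    by (simp add: sum_distrib_left mult_ac)
  also have "\<dots> = 0"
    using c by simp
  also have "trace q n (0::'a) = 0"
    using q_gt_1 by (simp add: trace_def power_0_left)
  finally show "c k = 0" .
qed

end

section \<open>The powers of \<open>lam\<close> as a basis\<close>

locale simple_finite_field_extension = finite_field_extension K q n
  for K :: "'a::{field,finite} set" and q n :: nat +
  fixes lam :: 'a and f :: "'a poly"
  assumes generates: "adjoin K lam = UNIV" and minpoly: "minimal_polynomial K lam f"
begin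

lemma coeff_K: "coeff f i \<in> K"
  using minpoly zero_K unfolding minimal_polynomial_def
  by (metis coeff_in_coeffs coeff_eq_0 not_less coeff_0 subsetD)

lemma lead_coeff_f: "lead_coeff f = 1" and poly_f_lam: "poly f lam = 0"
  and minimal_degree: "g \<noteq> 0 \<Longrightarrow> set (coeffs g) \<subseteq> K \<Longrightarrow> poly g lam = 0 \<Longrightarrow> degree f \<le> degree g"
  using minpoly by (auto simp: minimal_polynomial_def)

lemma f_nonzero: "f \<noteq> 0"
  using lead_coeff_f by auto

lemma degree_f_pos: "degree f > 0"
proof (rule ccontr)
  assume "\<not> degree f > 0"
  then obtain c where "f = [:c:]"
    by (auto elim: degree_eq_zeroE)
  then show False
    using lead_coeff_f poly_f_lam by simp
qed

text \<open>The length is \<open>degree f\<close>; that this equals \<open>n\<close> comes out of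
  the basis property in \<open>degree_f\<close>.\<close>

abbreviation powers :: "'a list" where
  "powers \<equiv> map (\<lambda>i. lam ^ i) [0..<degree f]"

text \<open>A nontrivial relation would be a nonzero polynomial over \<open>K\<close> of degree
  below \<open>degree f\<close> with root \<open>lam\<close>.\<close>

lemma lin_independent_powers: "lin_independent_over K powers"
  unfolding lin_independent_over_def
proof (intro allI impI)
  fix c k
  assume c: "(\<forall>i<length powers. c i \<in> K) \<and> (\<Sum>i<length powers. c i * powers ! i) = 0"
    and k: "k < length powers"
  define g where "g = (\<Sum>i<degree f. monom (c i) i)"
  have coeff_g: "coeff g i = (if i < degree f then c i else 0)" for i
    by (simp add: g_def coeff_sum)
  have "set (coeffs g) \<subseteq> K"
    using c by (auto simp: coeffs_def coeff_g zero_K)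
  moreover have "poly g lam = 0"
    using c by (simp add: g_def poly_sum poly_monom)
  moreover have "degree g < degree f"
    unfolding g_def using degree_f_pos
    by (intro degree_sum_less) (auto intro: le_less_trans[OF degree_monom_le])
  ultimately have "g = 0"
    using minimal_degree[of g] by auto
  then show "c k = 0"
    using coeff_g[of k] k by simp
qed

text \<open>It will turn out to be a subfield containing \<open>K\<close> and \<open>lam\<close>,
  hence the whole field, so that the powers span.\<close>

definition power_span :: "'a set" where
  "power_span = {\<Sum>i<degree f. c i * lam ^ i | c. \<forall>i<degree f. c i \<in> K}"

lemma power_spanI: "(\<And>i. i < degree f \<Longrightarrow> c i \<in> K) \<Longrightarrow> (\<Sum>i<degree f. c i * lam ^ i) \<in> power_span"
  by (auto simp: power_span_def)

lemma power_spanE: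
  assumes "x \<in> power_span"
  obtains c where "\<forall>i<degree f. c i \<in> K" "x = (\<Sum>i<degree f. c i * lam ^ i)"
  using assms by (auto simp: power_span_def)

lemma power_span_add:
  assumes "x \<in> power_span" "y \<in> power_span"
  shows "x + y \<in> power_span"
proof -
  obtain c d where "\<forall>i<degree f. c i \<in> K" "x = (\<Sum>i<degree f. c i * lam ^ i)"
    and "\<forall>i<degree f. d i \<in> K" "y = (\<Sum>i<degree f. d i * lam ^ i)"
    using assms by (metis power_spanE)
  then show ?thesis
    using power_spanI[of "\<lambda>i. c i + d i"] add_K by (simp add: sum.distrib algebra_simps)
qed

lemma power_span_scale:
  assumes "a \<in> K" "x \<in> power_span"
  shows "a * x \<in> power_span"
proof -
  obtain c where "\<forall>i<degree f. c i \<in> K" "x = (\<Sum>i<degree f. c i * lam ^ i)"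
    using assms(2) by (rule power_spanE)
  then show ?thesis
    using power_spanI[of "\<lambda>i. a * c i"] mult_K[OF assms(1)] by (simp add: sum_distrib_left mult_ac)
qed

lemma power_span_sum: "(\<And>i. i \<in> I \<Longrightarrow> g i \<in> power_span) \<Longrightarrow> sum g I \<in> power_span"
proof (induction I rule: infinite_finite_induct)
  case (insert i I)
  then show ?case
    by (simp add: power_span_add)
qed (use power_spanI[of "\<lambda>_. 0"] zero_K in simp_all)

lemma power_span_low: "i < degree f \<Longrightarrow> lam ^ i \<in> power_span"
  using power_spanI[of "\<lambda>j. if j = i then 1 else 0"] zero_K one_K
  by (simp add: if_distrib[of "\<lambda>x. x * _"] cong: if_cong)

text \<open>The monic relation \<open>poly f lam = 0\<close> is solved for its leading
  power.\<close>

lemma power_span_top: "lam ^ degree f \<in> power_span"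
proof -
  have "(\<Sum>i<degree f. coeff f i * lam ^ i) + lam ^ degree f = 0"
    using poly_f_lam lead_coeff_f by (simp add: poly_altdef lessThan_Suc_atMost[symmetric])
  then have "lam ^ degree f = (\<Sum>i<degree f. - coeff f i * lam ^ i)"
    by (simp add: sum_negf eq_neg_iff_add_eq_0 add.commute)
  then show ?thesis
    using power_spanI[of "\<lambda>i. - coeff f i"] uminus_K coeff_K by simp
qed

text \<open>Multiplication by \<open>lam\<close> shifts exponents by one, and the only power leaving
  the range is \<open>lam ^ degree f\<close>. Closure under products follows by iteration.\<close>

lemma power_span_lam:
  assumes "x \<in> power_span"
  shows "lam * x \<in> power_span"
proof -
  obtain c where c: "\<forall>i<degree f. c i \<in> K" "x = (\<Sum>i<degree f. c i * lam ^ i)"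
    using assms by (rule power_spanE)
  have "lam ^ Suc i \<in> power_span" if "i < degree f" for i
    using power_span_low[of "Suc i"] power_span_top that by (cases "Suc i = degree f") auto
  then have "(\<Sum>i<degree f. c i * lam ^ Suc i) \<in> power_span"
    using c(1) by (intro power_span_sum power_span_scale) auto
  then show ?thesis
    using c(2) by (simp add: sum_distrib_left mult_ac)
qed

lemma power_span_mult:
  assumes "x \<in> power_span" "y \<in> power_span"
  shows "x * y \<in> power_span"
proof -
  obtain c where c: "\<forall>i<degree f. c i \<in> K" "x = (\<Sum>i<degree f. c i * lam ^ i)"
    using assms(1) by (rule power_spanE)
  have "lam ^ i * y \<in> power_span" for i
    by (induction i) (use assms(2) power_span_lam in \<open>simp_all add: mult.assoc\<close>)
  then have "(\<Sum>i<degree f. c i * (lam ^ i * y)) \<in> power_span"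
    using c(1) by (intro power_span_sum) (auto intro: power_span_scale)
  then show ?thesis
    using c(2) by (simp add: sum_distrib_right mult.assoc)
qed

lemma one_power_span: "1 \<in> power_span"
  using power_span_low[of 0] degree_f_pos by simp

lemma is_subfield_power_span: "is_subfield power_span"
  unfolding is_subfield_def
proof (intro conjI ballI)
  show "0 \<in> power_span"
    using power_span_scale[OF zero_K one_power_span] by simp
  show "1 \<in> power_span"
    by (rule one_power_span)
  fix x assume x: "x \<in> power_span"
  show "- x \<in> power_span"
    using power_span_scale[OF uminus_K[OF one_K] x] by simp
  show "inverse x \<in> power_span"
  proof (cases "x = 0")
    case False
    \<comment> \<open>Multiplication by \<open>x\<close> is injective on the finite set \<open>power_span\<close>, hence onto.\<close>
    have "(\<lambda>y. x * y) ` power_span = power_span"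
      by (rule endo_inj_surj) (use False x in \<open>auto intro: power_span_mult inj_onI\<close>)
    then obtain y where "y \<in> power_span" "1 = x * y"
      using one_power_span by (metis imageE)
    then show ?thesis
      by (metis inverse_unique)
  qed (use x in simp)
qed (auto intro: power_span_add power_span_mult)

lemma power_span_UNIV: "power_span = UNIV"
proof -
  have "K \<subseteq> power_span"
    using power_span_scale[OF _ one_power_span] by auto
  moreover have "lam \<in> power_span"
    using power_span_lam[OF one_power_span] by simp
  ultimately have "adjoin K lam \<subseteq> power_span"
    unfolding adjoin_def using is_subfield_power_span by blast
  then show ?thesis
    using generates by blast
qed

lemma ordered_basis_powers: "ordered_basis K powers"
  unfolding ordered_basis_def spanning_over_def
proof (intro conjI allI lin_independent_powers)
  fix x
  have "x \<in> power_span"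
    using power_span_UNIV by blast
  then show "\<exists>c. (\<forall>i<length powers. c i \<in> K) \<and> x = (\<Sum>i<length powers. c i * powers ! i)"
    by (auto simp: power_span_def)
qed

lemma degree_f: "degree f = n"
  using ordered_basis_powers ordered_basis_iff by simp

lemma power_expansion:
  obtains c where "\<forall>i<n. c i \<in> K" "x = (\<Sum>i<n. c i * lam ^ i)"
proof -
  have "x \<in> power_span"
    by (simp add: power_span_UNIV)
  then show ?thesis
    by (rule power_spanE) (use that in \<open>simp add: degree_f\<close>)
qed

lemma power_combination_eq_0:
  assumes "\<And>i. i < n \<Longrightarrow> c i \<in> K" "(\<Sum>i<n. c i * lam ^ i) = 0" "i < n"
  shows "c i = 0"
proof -
  have "(\<forall>i<length powers. c i \<in> K) \<and> (\<Sum>i<length powers. c i * powers ! i) = 0"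
    using assms(1,2) by (simp add: degree_f)
  then have "\<forall>i<length powers. c i = 0"
    using lin_independent_powers unfolding lin_independent_over_def by blast
  then show ?thesis
    using assms(3) by (simp add: degree_f)
qed

section \<open>The conjugates of \<open>lam\<close> as the distinct roots of
  \<open>f\<close>\<close>

lemma frobenius_poly:
  assumes "\<And>i. coeff g i \<in> K"
  shows "poly g (a ^ (q ^ j)) = poly g a ^ (q ^ j)"
proof -
  have "poly g a ^ (q ^ j) = (\<Sum>i\<le>degree g. (coeff g i * a ^ i) ^ (q ^ j))"
    by (simp only: poly_altdef frobenius_sum)
  also have "\<dots> = (\<Sum>i\<le>degree g. coeff g i * (a ^ (q ^ j)) ^ i)"
    by (simp only: power_mult_distrib frobenius_K[OF assms] power_mult[symmetric] mult.commute[of _ "q ^ j"])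
  finally show ?thesis
    by (simp only: poly_altdef)
qed

abbreviation conjugate :: "nat \<Rightarrow> 'a" where
  "conjugate j \<equiv> lam ^ (q ^ j)"

lemma poly_f_conj: "poly f (conjugate j) = 0"
  using frobenius_poly[OF coeff_K, of lam j] q_gt_1 by (simp add: poly_f_lam power_0_left)

text \<open>The fixed points of \<open>x ^ (q ^ m)\<close> form a subfield containing
  \<open>K\<close> and \<open>lam\<close>, so they are all \<open>q ^ n\<close> elements; yet they
  are roots of a polynomial of degree \<open>q ^ m\<close>.\<close>

lemma frobenius_fixes_lam:
  assumes "conjugate m = lam" "0 < m"
  shows "n \<le> m"
proof (rule ccontr)
  assume "\<not> n \<le> m"
  define F where "F = {x::'a. x ^ (q ^ m) = x}"
  have "is_subfield F"
    using q_gt_1 by (auto simp: is_subfield_def F_def frobenius_add frobenius_minus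
      power_mult_distrib power_0_left power_inverse)
  moreover have "K \<subseteq> F" "lam \<in> F"
    using assms(1) by (auto simp: F_def frobenius_K)
  ultimately have "adjoin K lam \<subseteq> F"
    unfolding adjoin_def by blast
  then have F: "F = UNIV"
    using generates by blast
  \<comment> \<open>With \<open>0 < m\<close> the two monomials have different degrees, so the
    polynomial is nonzero of degree \<open>q ^ m\<close>.\<close>
  have "q ^ m > 1"
    using q_gt_1 assms(2) by (metis one_less_power)
  then have deg: "degree (monom 1 (q ^ m) + monom (-1) 1 :: 'a poly) = q ^ m"
    by (subst degree_add_eq_left) (auto simp: degree_monom_eq)
  then have "card {x::'a. poly (monom 1 (q ^ m) + monom (-1) 1) x = 0} \<le> q ^ m"
    using card_poly_roots_bound[of "monom 1 (q ^ m) + monom (-1) 1 :: 'a poly"] \<open>q ^ m > 1\<close>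
    by (metis degree_0 not_one_less_zero)
  moreover have "{x::'a. poly (monom 1 (q ^ m) + monom (-1) 1) x = 0} = UNIV"
    using F by (auto simp: F_def poly_monom)
  ultimately have "q ^ n \<le> q ^ m"
    using card_UNIV by simp
  then show False
    using q_gt_1 \<open>\<not> n \<le> m\<close> by simp
qed

text \<open>If two conjugates agree, cancelling the injective power \<open>q ^ i\<close> leaves
  \<open>lam\<close> fixed with exponent \<open>q ^ (j - i)\<close>, impossible as
  \<open>0 < j - i < n\<close>. This supplies the \<open>n\<close> distinct roots for Euler's
  formula.\<close>

lemma inj_on_conj: "inj_on conjugate {..<n}"
proof (rule linorder_inj_onI)
  fix i j assume ij: "i < j" "i \<in> {..<n}" "j \<in> {..<n}"
  show "conjugate i \<noteq> conjugate j"
  proof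
    assume "conjugate i = conjugate j"
    also have "\<dots> = conjugate (j - i) ^ (q ^ i)"
      using ij by (simp flip: power_mult power_add)
    finally have "conjugate (j - i) = lam"
      using frobenius_inj by metis
    then show False
      using frobenius_fixes_lam[of "j - i"] ij by auto
  qed
qed auto

section \<open>The dual basis of the powers and the coefficients \<open>A j\<close>\<close>

definition dual_power :: "nat \<Rightarrow> 'a" where
  "dual_power i = coeff (synthetic_div f lam) i / poly (pderiv f) lam"

text \<open>The coefficients of \<open>f\<close> keep the exponent \<open>q ^ j\<close> although
  they lie in \<open>K\<close>: this is the shape required for \<open>A j\<close>.\<close>

lemma dual_power_frobenius:
  "dual_power i ^ (q ^ j) = (\<Sum>h=1..n - i. lam ^ ((h - 1) * q ^ j) * coeff f (i + h) ^ (q ^ j))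
     / poly (pderiv f) lam ^ (q ^ j)"
  by (simp add: dual_power_def power_divide coeff_synthetic_div degree_f frobenius_sum
      power_mult_distrib power_mult)

text \<open>Frobenius fixes the coefficients of \<open>f\<close> and of its derivative and moves
  only \<open>lam\<close>, so a trace becomes a sum over the roots of \<open>f\<close>.\<close>

lemma dual_power_conj:
  "dual_power i ^ (q ^ j) = coeff (synthetic_div f (conjugate j)) i / poly (pderiv f) (conjugate j)"
proof -
  have "coeff (pderiv f) i \<in> K" for i
    unfolding coeff_pderiv by (intro mult_K of_nat_K coeff_K)
  then have "poly (pderiv f) (conjugate j) = poly (pderiv f) lam ^ (q ^ j)"
    by (rule frobenius_poly)
  moreover have "lam ^ ((h - 1) * q ^ j) * coeff f (i + h) ^ (q ^ j) = conjugate j ^ (h - 1) * coeff f (i + h)" for h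
    using frobenius_K[OF coeff_K] by (simp add: mult.commute flip: power_mult)
  ultimately show ?thesis
    unfolding dual_power_frobenius by (simp add: coeff_synthetic_div degree_f)
qed

text \<open>This is Euler's formula at the conjugates of \<open>lam\<close>.\<close>

lemma trace_power_dual_power:
  assumes "k < n"
  shows "trace q n (lam ^ k * dual_power i) = (if k = i then 1 else 0)"
proof -
  have "trace q n (lam ^ k * dual_power i)
      = (\<Sum>j<n. conjugate j ^ k * (coeff (synthetic_div f (conjugate j)) i / poly (pderiv f) (conjugate j)))"
    by (simp add: trace_def power_mult_distrib dual_power_conj) (simp add: mult.commute flip: power_mult)
  then show ?thesis
    using sum_root_powers_synthetic_div[OF degree_f f_nonzero inj_on_conj poly_f_conj assms] by auto
qed

lemma dual_basis_powers: "dual_basis K q n (map (\<lambda>i. lam ^ i) [0..<n]) = map dual_power [0..<n]"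
proof -
  \<comment> \<open>By \<open>ordered_basis_iff\<close>, independence of these \<open>n\<close>
    elements makes them a basis.\<close>
  have "lin_independent_over K (map dual_power [0..<n])"
    by (rule lin_independent_over_of_trace[of "map (\<lambda>i. lam ^ i) [0..<n]"])
       (simp_all add: trace_power_dual_power)
  then have "dual_bases K q n (map (\<lambda>i. lam ^ i) [0..<n]) (map dual_power [0..<n])"
    using ordered_basis_powers
    by (simp add: dual_bases_def trace_power_dual_power degree_f ordered_basis_iff)
  \<comment> \<open>Uniqueness of the dual basis evaluates the \<open>THE\<close> in
    \<open>dual_basis\<close>.\<close>
  then show ?thesis
    unfolding dual_basis_def by (blast intro: dual_bases_unique)
qed

text \<open>Each trace in the definition of \<open>p\<close> thus reads off one coordinate, which
  makes \<open>p\<close> a projection.\<close>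

lemma trace_dual_power_combination:
  assumes "\<And>i. i < n \<Longrightarrow> c i \<in> K" "k < n"
  shows "trace q n (dual_power k * (\<Sum>i<n. c i * lam ^ i)) = c k"
proof -
  have "trace q n (dual_power k * (\<Sum>i<n. c i * lam ^ i))
      = trace q n (\<Sum>i<n. c i * (lam ^ i * dual_power k))"
    by (simp add: sum_distrib_left mult_ac)
  also have "\<dots> = (\<Sum>i<n. c i * trace q n (lam ^ i * dual_power k))"
    using assms(1) by (rule trace_combination)
  also have "\<dots> = (\<Sum>i<n. c i * (if i = k then 1 else 0))"
    by (intro sum.cong) (simp_all add: trace_power_dual_power)
  also have "\<dots> = c k"
    using assms(2) by (simp add: if_distrib[of "(*) _"] cong: if_cong)
  finally show ?thesis .
qed

text \<open>Expand each trace into Frobenius powers, exchange the two sums and insert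
  \<open>dual_power_frobenius\<close>.\<close>

lemma trace_polynomial:
  assumes "t \<le> n"
  shows "(\<Sum>i=t..n - 1. lam ^ i * trace q n (dual_power i * x))
    = (\<Sum>j<n. 1 / poly (pderiv f) lam ^ (q ^ j) *
         (\<Sum>i=t..n - 1. \<Sum>h=1..n - i. lam ^ (i + (h - 1) * q ^ j) * coeff f (i + h) ^ (q ^ j))
         * x ^ (q ^ j))"
proof -
  have "(\<Sum>i=t..n - 1. lam ^ i * trace q n (dual_power i * x))
      = (\<Sum>j<n. \<Sum>i=t..n - 1. lam ^ i * dual_power i ^ (q ^ j) * x ^ (q ^ j))"
    by (subst sum.swap) (simp add: trace_def sum_distrib_left power_mult_distrib mult_ac)
  also have "\<dots> = (\<Sum>j<n. 1 / poly (pderiv f) lam ^ (q ^ j) *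
         (\<Sum>i=t..n - 1. \<Sum>h=1..n - i. lam ^ (i + (h - 1) * q ^ j) * coeff f (i + h) ^ (q ^ j))
         * x ^ (q ^ j))"
    unfolding dual_power_frobenius power_add
    by (simp add: sum_distrib_left sum_distrib_right sum_divide_distrib mult_ac)
  finally show ?thesis .
qed

end

section \<open>The projectivity that relates the two point sets\<close>

lemma image_pt: "(*v) M ` pt x y = pt ((M *v vector [x, y]) $ 1) ((M *v vector [x, y]) $ 2)"
proof -
  have "M *v vector [x, y] = vector [(M *v vector [x, y]) $ 1, (M *v vector [x, y]) $ 2]"
    by (simp add: vec_eq_iff forall_2)
  then show ?thesis
    unfolding pt_def
    by (subst vec.linear_span_image[OF matrix_vector_mul_linear_gen, symmetric]) simp
qed

text \<open>Both sets run over the same parameters, so it suffices that one matrix sends each point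
  of \<open>L\<close> to the point of \<open>L'\<close> with the same parameter.\<close>

lemma PGL2_equivalent_shear:
  fixes s :: "'a::field"
  assumes "s \<noteq> 0" "L = {pt (g x) (h x) | x. P x}" "L' = {pt (g x + s * h x) (s * h x) | x. P x}"
  shows "PGL2_equivalent L L'"
proof -
  define M :: "'a ^ 2 ^ 2" where "M = vector [vector [1, s], vector [0, s]]"
  \<comment> \<open>The inverse map is \<open>(x, y) -> (x - y, y / s)\<close>.\<close>
  define M' :: "'a ^ 2 ^ 2" where "M' = vector [vector [1, - 1], vector [0, inverse s]]"
  have "M ** M' = mat 1" "M' ** M = mat 1"
    using assms(1) by (simp_all add: M_def M'_def matrix_matrix_mult_def mat_def vec_eq_iff forall_2 sum_2)
  then have "invertible M"
    unfolding invertible_def by blast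
  moreover have "(*v) M ` pt x y = pt (x + s * y) (s * y)" for x y
    unfolding image_pt by (simp add: M_def matrix_vector_mult_def sum_2)
  then have "(\<lambda>P. (*v) M ` P) ` L = L'"
    unfolding assms(2,3) by (auto simp: image_iff) metis+
  ultimately show ?thesis
    unfolding PGL2_equivalent_def PGL2_def by (intro bexI[of _ "\<lambda>P. (*v) M ` P"]) auto
qed

lemma sum_split_shift_powers:
  fixes c :: "nat \<Rightarrow> 'a::comm_semiring_1"
  assumes "t \<le> n"
  shows "(\<Sum>i<n. c i * a ^ i) = (\<Sum>i<t. c i * a ^ i) + a ^ t * (\<Sum>i<n - t. c (t + i) * a ^ i)"
    and "(\<Sum>i=t..<n. c i * a ^ i) = a ^ t * (\<Sum>i<n - t. c (t + i) * a ^ i)"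
proof -
  show *: "(\<Sum>i=t..<n. c i * a ^ i) = a ^ t * (\<Sum>i<n - t. c (t + i) * a ^ i)"
    using sum.atLeastLessThan_shift_0[of "\<lambda>i. c i * a ^ i" t n]
    by (simp add: sum_distrib_left power_add mult_ac atLeast0LessThan)
  have "{..<n} = {..<t} \<union> {t..<n}"
    using assms by auto
  then show "(\<Sum>i<n. c i * a ^ i) = (\<Sum>i<t. c i * a ^ i) + a ^ t * (\<Sum>i<n - t. c (t + i) * a ^ i)"
    unfolding *[symmetric] by (simp add: sum.union_disjoint ivl_disj_int)
qed

section \<open>The equivalence and the polynomial form of \<open>p\<close>\<close>

theorem theorem5p2:
  fixes K :: "'a::{field,finite} set"
    and q n t :: nat
    and lam \<delta> :: 'a
    and f :: "'a poly"
    and dual :: "'a list"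
    and p :: "'a \<Rightarrow> 'a"
    and A :: "nat \<Rightarrow> 'a"
    and L L\<^sub>p :: "('a ^ 2) set set"
  assumes "is_subfield K" and "card K = q" and "CARD('a) = q ^ n"
    and "lam \<notin> K" and "adjoin K lam = UNIV"
    and "minimal_polynomial K lam f"
    and "\<delta> = poly (pderiv f) lam"
    and "1 \<le> t" and "t \<le> n - 1"
    and "L = {pt (\<Sum>i<t. \<alpha> i * lam ^ i) (\<Sum>i<n - t. \<beta> i * lam ^ i) | \<alpha> \<beta>.
               (\<forall>i<t. \<alpha> i \<in> K) \<and> (\<forall>i<n - t. \<beta> i \<in> K) \<and>
               ((\<exists>i<t. \<alpha> i \<noteq> 0) \<or> (\<exists>i<n - t. \<beta> i \<noteq> 0))}"
    and "dual = dual_basis K q n (map (\<lambda>i. lam ^ i) [0..<n])"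
    and "p = (\<lambda>x. \<Sum>i=t..n - 1. lam ^ i * trace q n (dual ! i * x))"
    and "A = (\<lambda>j. 1 / \<delta> ^ (q ^ j) *
               (\<Sum>i=t..n - 1. \<Sum>h=1..n - i.
                  lam ^ (i + (h - 1) * q ^ j) * coeff f (i + h) ^ (q ^ j)))"
    and "L\<^sub>p = {pt x (p x) | x. x \<noteq> 0}"
  shows "PGL2_equivalent L L\<^sub>p \<and> (\<forall>x. p x = (\<Sum>j<n. A j * x ^ (q ^ j)))"
proof
  interpret simple_finite_field_extension K q n lam f
    using assms(1-6) by unfold_locales
  have t: "t \<le> n"
    using assms(9) by simp
  \<comment> \<open>Since \<open>n > 0\<close>, every index up to \<open>n - 1\<close> lies inside
    the list \<open>dual\<close>.\<close>
  have p: "p x = (\<Sum>i=t..n - 1. lam ^ i * trace q n (dual_power i * x))" for x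
    unfolding assms(11,12) dual_basis_powers using n_pos by (auto intro!: sum.cong)
  show "\<forall>x. p x = (\<Sum>j<n. A j * x ^ (q ^ j))"
    unfolding p assms(7,13) using trace_polynomial[OF t] by blast

  \<comment> \<open>A single nonzero coordinate vector \<open>c\<close> of length \<open>n\<close>
    parametrizes both point sets: \<open>g\<close> uses its first \<open>t\<close> entries,
    \<open>h\<close> the remaining \<open>n - t\<close>.\<close>
  define P where "P = (\<lambda>c. (\<forall>i<n. c i \<in> K) \<and> (\<exists>i<n. c i \<noteq> 0))"
  define g where "g = (\<lambda>c. \<Sum>i<t. c i * lam ^ i)"
  define h where "h = (\<lambda>c. \<Sum>i<n - t. c (t + i) * lam ^ i)"
  have expand: "(\<Sum>i<n. c i * lam ^ i) = g c + lam ^ t * h c" for c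
    unfolding g_def h_def by (rule sum_split_shift_powers(1)[OF t])
  have p_expand: "p (\<Sum>i<n. c i * lam ^ i) = lam ^ t * h c" if "P c" for c
  proof -
    have "p (\<Sum>i<n. c i * lam ^ i) = (\<Sum>i=t..n - 1. lam ^ i * c i)"
      unfolding p using that n_pos
      by (intro sum.cong arg_cong[of _ _ "(*) _"] trace_dual_power_combination refl) (auto simp: P_def)
    \<comment> \<open>\<open>n > 0\<close> matters here, as \<open>n - 1\<close> is a truncated
      subtraction.\<close>
    also have "{t..n - 1} = {t..<n}"
      using n_pos by auto
    finally show ?thesis
      unfolding h_def sum_split_shift_powers(2)[OF t, symmetric] by (simp add: mult.commute)
  qed
  have "L = {pt (g c) (h c) | c. P c}"
  proof (intro equalityI subsetI)
    fix u assume "u \<in> L"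
    then obtain \<alpha> \<beta> where u: "u = pt (\<Sum>i<t. \<alpha> i * lam ^ i) (\<Sum>i<n - t. \<beta> i * lam ^ i)"
      and K: "\<forall>i<t. \<alpha> i \<in> K" "\<forall>i<n - t. \<beta> i \<in> K"
      and nz: "(\<exists>i<t. \<alpha> i \<noteq> 0) \<or> (\<exists>i<n - t. \<beta> i \<noteq> 0)"
      unfolding assms(10) by blast
    \<comment> \<open>The concatenation of \<alpha> and \<beta>.\<close>
    define c where "c = (\<lambda>i. if i < t then \<alpha> i else \<beta> (i - t))"
    have "u = pt (g c) (h c)"
      by (simp add: u g_def h_def c_def)
    moreover have "\<forall>i<n. c i \<in> K"
      using K by (auto simp: c_def)
    moreover have "\<exists>i<n. c i \<noteq> 0"
      using nz
    proof
      assume "\<exists>i<t. \<alpha> i \<noteq> 0"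
      then obtain i where "i < t" "\<alpha> i \<noteq> 0"
        by blast
      then show ?thesis
        using t by (intro exI[of _ i]) (simp add: c_def)
    next
      assume "\<exists>i<n - t. \<beta> i \<noteq> 0"
      then obtain i where "i < n - t" "\<beta> i \<noteq> 0"
        by blast
      then show ?thesis
        by (intro exI[of _ "t + i"]) (simp add: c_def)
    qed
    ultimately show "u \<in> {pt (g c) (h c) | c. P c}"
      unfolding P_def by blast
  next
    fix u assume "u \<in> {pt (g c) (h c) | c. P c}"
    then obtain c where u: "u = pt (g c) (h c)" and K: "\<forall>i<n. c i \<in> K" and nz: "\<exists>i<n. c i \<noteq> 0"
      unfolding P_def by blast
    have "(\<exists>i<t. c i \<noteq> 0) \<or> (\<exists>i<n - t. c (t + i) \<noteq> 0)"
    proof -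
      obtain i where i: "i < n" "c i \<noteq> 0"
        using nz by blast
      show ?thesis
      proof (cases "i < t")
        case False
        then have "i - t < n - t" "c (t + (i - t)) \<noteq> 0"
          using i by auto
        then show ?thesis
          by blast
      qed (use i in blast)
    qed
    then show "u \<in> L"
      unfolding assms(10) u g_def h_def using K t
      by (intro CollectI exI[of _ c] exI[of _ "\<lambda>i. c (t + i)"]) auto
  qed
  moreover have "L\<^sub>p = {pt (g c + lam ^ t * h c) (lam ^ t * h c) | c. P c}"
  proof -
    \<comment> \<open>Because the powers of \<open>lam\<close> form a basis, nonzero field elements
      correspond to nonzero coordinate vectors. This matches \<open>x \<noteq> 0\<close> with the
      condition that not all coefficients vanish.\<close>
    have nonzero: "{x. x \<noteq> 0} = {\<Sum>i<n. c i * lam ^ i | c. P c}"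
    proof (intro equalityI subsetI)
      fix x assume x: "x \<in> {x::'a. x \<noteq> 0}"
      obtain c where c: "\<forall>i<n. c i \<in> K" "x = (\<Sum>i<n. c i * lam ^ i)"
        by (rule power_expansion)
      have "\<exists>i<n. c i \<noteq> 0"
      proof (rule ccontr)
        assume "\<not> (\<exists>i<n. c i \<noteq> 0)"
        then show False
          using x c(2) by simp
      qed
      then show "x \<in> {\<Sum>i<n. c i * lam ^ i | c. P c}"
        unfolding P_def using c by blast
    next
      fix x assume "x \<in> {\<Sum>i<n. c i * lam ^ i | c. P c}"
      then obtain c i where c: "\<And>i. i < n \<Longrightarrow> c i \<in> K" "x = (\<Sum>i<n. c i * lam ^ i)"
        and i: "i < n" "c i \<noteq> 0"
        unfolding P_def by blast
      have "x \<noteq> 0"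
      proof
        assume "x = 0"
        then have "c i = 0"
          by (intro power_combination_eq_0[OF c(1) _ i(1)]) (simp_all only: c(2))
        then show False
          using i(2) by simp
      qed
      then show "x \<in> {x. x \<noteq> 0}"
        by simp
    qed
    have "L\<^sub>p = (\<lambda>x. pt x (p x)) ` {x. x \<noteq> 0}"
      unfolding assms(14) by (rule setcompr_eq_image)
    also have "\<dots> = {pt (\<Sum>i<n. c i * lam ^ i) (p (\<Sum>i<n. c i * lam ^ i)) | c. P c}"
      unfolding nonzero setcompr_eq_image image_image ..
    also have "\<dots> = {pt (g c + lam ^ t * h c) (lam ^ t * h c) | c. P c}"
    proof (intro Collect_cong ex_cong1)
      fix u c
      show "(u = pt (\<Sum>i<n. c i * lam ^ i) (p (\<Sum>i<n. c i * lam ^ i)) \<and> P c)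
          \<longleftrightarrow> (u = pt (g c + lam ^ t * h c) (lam ^ t * h c) \<and> P c)"
        by (cases "P c") (simp_all only: p_expand expand[symmetric] simp_thms)
    qed
    finally show ?thesis .
  qed
  \<comment> \<open>\<open>lam\<close> is nonzero because \<open>0\<close> lies in \<open>K\<close>
    and \<open>lam\<close> does not; this makes the matrix invertible.\<close>
  moreover have "lam ^ t \<noteq> 0"
    using assms(4) zero_K by auto
  ultimately show "PGL2_equivalent L L\<^sub>p"
    by (intro PGL2_equivalent_shear[of "lam ^ t" L g h P])
qed

end
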